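(* Let $B\subset[d]\times[d]$ be a board, and let $B'=([d]\times[d])\setminus B$ be the complementary board. Then $R(B';i)=(-1)^d\,R(B;-i-1)$ (as polynomials in $i$).
   Context: $[d]=\{1,2,\dots,d\}$. For a board $B\subset[d]\times[d]$, the rook number $r_k^B$ is the number of $k$-element subsets of $B$ such that no two squares lie in the same row or in the same column. With $i^{\underline k}=i(i-1)\cdots(i-k+1)$, the ($d$-)factorial polynomial of $B$ is $R(B;i)=\sum_{k} r_k^B\, i^{\underline{d-k}}$. *)

theory Defs
  imports "HOL-Computational_Algebra.Polynomial"
begin

type_synonym board = "(nat \<times> nat) set"

definition full_board :: "nat \<Rightarrow> board" where
  "full_board d = {1..d} \<times> {1..d}"

definition non_attacking :: "board \<Rightarrow> bool" where
  "non_attacking S \<longleftrightarrow> inj_on fst S \<and> inj_on snd S"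

definition rook_number :: "board \<Rightarrow> nat \<Rightarrow> nat" where
  "rook_number B k = card {S. S \<subseteq> B \<and> finite S \<and> card S = k \<and> non_attacking S}"

definition falling_factorial :: "'a::comm_ring_1 \<Rightarrow> nat \<Rightarrow> 'a" where
  "falling_factorial x k = (\<Prod>j<k. x - of_nat j)"

(* [:0, 1:] is the indeterminate i.  Stopping the sum at d loses nothing for a board inside
   the d x d square: at most d non-attacking squares fit, one per row.  It also keeps the
   natural-number subtraction d - k from truncating. *)
definition factorial_polynomial :: "nat \<Rightarrow> board \<Rightarrow> int poly" where
  "factorial_polynomial d B =
     (\<Sum>k\<le>d. of_nat (rook_number B k) * falling_factorial [:0, 1:] (d - k))"

end

theory Submission
  imports Defs
begin

text \<open>
  Instead of rook numbers, sum over the placements themselves: \<open>R(B; x)\<close> is the sum of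
  \<open>x (x - 1) \<dots>\<close> with \<open>d - |S|\<close> factors over all non-attacking \<open>S \<subseteq> B\<close>.
  Placements avoiding \<open>B\<close> are picked out of all placements on the square by inclusion-exclusion
  over the subset \<open>T \<subseteq> S \<inter> B\<close>, so \<open>R(B'; x)\<close> is the sum over placements \<open>T\<close> in \<open>B\<close> of
  \<open>(-1)^|T|\<close> times the total weight of the placements \<open>S \<supseteq> T\<close> on the whole square
  (\<open>sum_placements_avoiding\<close>).

  Deleting the rows and columns of \<open>T\<close> identifies these \<open>S\<close> with the placements on a square of
  side \<open>n = d - |T|\<close>. Their total weight is \<open>(x + 1) \<dots> (x + n)\<close>, the factorial polynomial of
  a full square (\<open>sum_placements_rectangle\<close>). Reversing the signs of all its factors turns that
  product into \<open>(-1)^n\<close> times the falling factorial of \<open>-x - 1\<close> of length \<open>n\<close>, which is the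
  term of \<open>T\<close> in \<open>R(B; -x - 1)\<close>; the signs combine to \<open>(-1)^|T| (-1)^(d - |T|) = (-1)^d\<close>.
\<close>

section \<open>Factorial polynomials as sums over placements\<close>

definition placements :: "board \<Rightarrow> board set" where
  "placements B = {S. S \<subseteq> B \<and> non_attacking S}"

lemma finite_placements [simp]: "finite B \<Longrightarrow> finite (placements B)"
  by (simp add: placements_def)

lemma placementsD:
  assumes "S \<in> placements B"
  shows "S \<subseteq> B" "inj_on fst S" "inj_on snd S"
  using assms by (auto simp: placements_def non_attacking_def)

lemma finite_placement: "finite B \<Longrightarrow> S \<in> placements B \<Longrightarrow> finite S"
  using placementsD(1) finite_subset by blast

lemma card_placement_le_rows:
  assumes "finite I" "S \<in> placements (I \<times> J)"
  shows "card S \<le> card I"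
  using placementsD[OF assms(2)] assms(1) by (intro card_inj_on_le[of fst]) auto

lemma falling_factorial_Suc:
  "falling_factorial x (Suc n) = falling_factorial x n * (x - of_nat n)"
  by (simp add: falling_factorial_def)

text \<open>
  The definition groups the placements by their number of rooks. No placement has more than \<open>d\<close>
  rooks, so cutting the groups off at \<open>d\<close> omits none.
\<close>

lemma factorial_polynomial_eq_sum_placements:
  assumes "B \<subseteq> full_board d"
  shows "factorial_polynomial d B
    = (\<Sum>S\<in>placements B. falling_factorial [:0, 1:] (d - card S))"
proof -
  have fin: "finite B"
    using assms by (rule finite_subset) (simp add: full_board_def)
  have le: "card S \<le> d" if "S \<in> placements B" for S
    using card_placement_le_rows[of "{1..d}" S "{1..d}"] that assms
    by (auto simp: placements_def full_board_def)
  have eq: "{S \<in> placements B. card S = k}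
      = {S. S \<subseteq> B \<and> finite S \<and> card S = k \<and> non_attacking S}" for k
    using fin finite_subset by (auto simp: placements_def)
  have "(\<Sum>S\<in>placements B. falling_factorial [:0, 1:] (d - card S))
      = (\<Sum>k\<le>d. \<Sum>S\<in>{S \<in> placements B. card S = k}.
           falling_factorial ([:0, 1:] :: int poly) (d - card S))"
    using fin le by (intro sum.group[symmetric]) auto
  also have "\<dots> = factorial_polynomial d B"
    unfolding factorial_polynomial_def rook_number_def eq[symmetric]
    by (intro sum.cong) auto
  finally show ?thesis by simp
qed

section \<open>Placements on a rectangle\<close>

text \<open>
  A new row holds at most one rook, which may stand in any column that \<open>S\<close> leaves free. This
  decomposition drives the induction over the rows of a rectangle.
\<close>

lemma placements_insert_row:
  assumes "i \<notin> I"
  shows "placements (insert i I \<times> J) = placements (I \<times> J) \<union>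
    (\<lambda>(S, j). insert (i, j) S) ` (SIGMA S:placements (I \<times> J). J - snd ` S)"
    (is "?L = ?A \<union> ?f ` ?P")
proof (intro equalityI subsetI)
  fix S assume S: "S \<in> ?L"
  note S' = placementsD[OF S]
  show "S \<in> ?A \<union> ?f ` ?P"
  proof (cases "\<exists>j. (i, j) \<in> S")
    case False
    then show ?thesis using S by (auto simp: placements_def)
  next
    case True
    then obtain j where j: "(i, j) \<in> S" by blast
    have "S - {(i, j)} \<subseteq> I \<times> J"
      using S'(1) inj_onD[OF S'(2) _ j] by fastforce
    moreover have "j \<notin> snd ` (S - {(i, j)})"
      using inj_onD[OF S'(3) _ j] by fastforce
    moreover have "non_attacking (S - {(i, j)})"
      using S'(2,3) by (auto simp: non_attacking_def intro: inj_on_subset)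
    ultimately have "(S - {(i, j)}, j) \<in> ?P"
      using S'(1) j by (auto simp: placements_def)
    moreover have "S = ?f (S - {(i, j)}, j)" using j by auto
    ultimately show ?thesis by blast
  qed
next
  fix S assume "S \<in> ?A \<union> ?f ` ?P"
  then show "S \<in> ?L"
  proof
    assume "S \<in> ?A" then show ?thesis by (auto simp: placements_def)
  next
    assume "S \<in> ?f ` ?P"
    then obtain T j where T: "T \<in> ?A" "j \<in> J" "j \<notin> snd ` T" "S = insert (i, j) T"
      by auto
    have "i \<notin> fst ` T" using placementsD(1)[OF T(1)] assms by auto
    then show ?thesis using T placementsD[OF T(1)]
      by (auto simp: placements_def non_attacking_def)
  qed
qed

text \<open>
  For a natural number \<open>x\<close> this counts the injections of the rows into the columns together with
  \<open>x\<close> extra values: \<open>S\<close> records the rows sent to genuine columns, and the falling factorial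
  counts the ways to send the others to extra values. The proof adds the rows one at a time.
  Without a rook in the new row the weight of a placement \<open>S\<close> with \<open>k\<close> rooks on \<open>n\<close> rows and
  \<open>m\<close> columns gains the factor \<open>x - (n - k)\<close>; a rook there can stand in \<open>m - k\<close> columns and
  keeps the weight. The total factor \<open>x + m - n\<close> no longer depends on \<open>k\<close>, so it comes out of
  the sum.
\<close>

lemma sum_placements_rectangle:
  fixes x :: "'a::comm_ring_1"
  assumes "finite I" "finite J"
  shows "(\<Sum>S\<in>placements (I \<times> J). falling_factorial x (card I - card S))
    = falling_factorial (x + of_nat (card J)) (card I)"
  using assms(1)
proof (induction I rule: finite_induct)
  case empty
  have "placements ({} \<times> J) = {{}}" by (auto simp: placements_def non_attacking_def)
  then show ?case by (simp add: falling_factorial_def)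
next
  case (insert i I)
  let ?n = "card I" and ?A = "placements (I \<times> J)"
  let ?P = "SIGMA S:?A. J - snd ` S"
  let ?f = "\<lambda>(S, j). insert (i, j) S"
  let ?g = "\<lambda>S. falling_factorial x (Suc ?n - card S)"
  have fin: "finite (I \<times> J)" using insert assms by simp
  have fresh: "(i, j) \<notin> S" if "S \<in> ?A" for S j
    using placementsD(1)[OF that] insert.hyps by auto
  have inj: "inj_on ?f ?P"
  proof (rule inj_onI, clarify)
    fix S j S' j'
    assume S: "S \<in> ?A" "S' \<in> ?A" and eq: "insert (i, j) S = insert (i, j') S'"
    have "j = j'" using eq fresh[OF S(2), of j] by blast
    with eq fresh[OF S(1)] fresh[OF S(2)] show "S = S' \<and> j = j'"
      by (simp add: insert_ident)
  qed
  have disj: "?A \<inter> ?f ` ?P = {}" using fresh by auto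
  have row: "?g S + (\<Sum>j\<in>J - snd ` S. ?g (insert (i, j) S))
      = falling_factorial x (?n - card S) * (x + of_nat (card J) - of_nat ?n)"
    if S: "S \<in> ?A" for S
  proof -
    note S' = placementsD[OF S]
    have finS: "finite S" using S fin finite_placement by blast
    have le: "card S \<le> ?n" using S insert.hyps card_placement_le_rows by blast
    have sub: "snd ` S \<subseteq> J" using S'(1) by auto
    have card: "card (snd ` S) = card S" using S'(3) card_image by blast
    then have leJ: "card S \<le> card J" using sub assms(2) card_mono by metis
    have cardD: "card (J - snd ` S) = card J - card S"
      using sub finS card by (simp add: card_Diff_subset)
    have no_rook: "?g S = falling_factorial x (?n - card S) * (x - of_nat (?n - card S))"
      using le by (simp add: Suc_diff_le falling_factorial_Suc)
    have rook: "(\<Sum>j\<in>J - snd ` S. ?g (insert (i, j) S))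
        = of_nat (card J - card S) * falling_factorial x (?n - card S)"
      using fresh[OF S] finS by (simp add: cardD)
    show ?thesis
      unfolding no_rook rook using le leJ by (simp add: of_nat_diff algebra_simps)
  qed
  have "(\<Sum>S\<in>placements (insert i I \<times> J). ?g S) = sum ?g ?A + sum ?g (?f ` ?P)"
    unfolding placements_insert_row[OF insert.hyps(2)]
    using fin disj assms(2) by (intro sum.union_disjoint) auto
  also have "sum ?g (?f ` ?P) = (\<Sum>(S, j)\<in>?P. ?g (insert (i, j) S))"
    unfolding sum.reindex[OF inj] by (simp add: case_prod_unfold)
  also have "\<dots> = (\<Sum>S\<in>?A. \<Sum>j\<in>J - snd ` S. ?g (insert (i, j) S))"
    using fin assms(2) by (intro sum.Sigma[symmetric]) auto
  also have "sum ?g ?A + \<dots> = (\<Sum>S\<in>?A. falling_factorial x (?n - card S)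
      * (x + of_nat (card J) - of_nat ?n))"
    unfolding sum.distrib[symmetric] by (intro sum.cong refl row)
  also have "\<dots> = falling_factorial (x + of_nat (card J)) (Suc ?n)"
    by (simp add: sum_distrib_right[symmetric] insert.IH falling_factorial_Suc)
  finally show ?case using insert.hyps by simp
qed

section \<open>Placements containing or avoiding given squares\<close>

text \<open>
  The rooks that extend \<open>T\<close> are exactly the placements in the rows and columns that \<open>T\<close> leaves
  free.
\<close>

lemma bij_betw_placements_containing:
  assumes "T \<in> placements (I \<times> J)"
  shows "bij_betw (\<lambda>U. T \<union> U) (placements ((I - fst ` T) \<times> (J - snd ` T)))
    {S \<in> placements (I \<times> J). T \<subseteq> S}"
proof (rule bij_betw_byWitness[where f' = "\<lambda>S. S - T"])
  note T = placementsD[OF assms]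
  let ?R = "placements ((I - fst ` T) \<times> (J - snd ` T))"
  show "\<forall>U\<in>?R. T \<union> U - T = U" by (force simp: placements_def)
  show "\<forall>S\<in>{S \<in> placements (I \<times> J). T \<subseteq> S}. T \<union> (S - T) = S" by blast
  show "(\<lambda>U. T \<union> U) ` ?R \<subseteq> {S \<in> placements (I \<times> J). T \<subseteq> S}"
  proof clarsimp
    fix U assume "U \<in> ?R"
    note U = placementsD[OF this]
    have "fst ` (T - U) \<inter> fst ` (U - T) = {}" "snd ` (T - U) \<inter> snd ` (U - T) = {}"
      using U(1) by force+
    then show "T \<union> U \<in> placements (I \<times> J)"
      using T U by (auto simp: placements_def non_attacking_def inj_on_Un)
  qed
  show "(\<lambda>S. S - T) ` {S \<in> placements (I \<times> J). T \<subseteq> S} \<subseteq> ?R"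
  proof clarsimp
    fix S assume S: "S \<in> placements (I \<times> J)" "T \<subseteq> S"
    note S' = placementsD[OF S(1)]
    have "fst ` (S - T) \<inter> fst ` T = {}" "snd ` (S - T) \<inter> snd ` T = {}"
      using S' S(2) by (fastforce simp: inj_on_def)+
    then have "S - T \<subseteq> (I - fst ` T) \<times> (J - snd ` T)"
      using S'(1) by force
    then show "S - T \<in> ?R"
      using S' by (auto simp: placements_def non_attacking_def intro: inj_on_subset)
  qed
qed

lemma sum_placements_containing:
  fixes x :: "'a::comm_ring_1"
  assumes "finite I" "finite J" "T \<in> placements (I \<times> J)"
  shows "(\<Sum>S | S \<in> placements (I \<times> J) \<and> T \<subseteq> S. falling_factorial x (card I - card S))
    = falling_factorial (x + of_nat (card J - card T)) (card I - card T)"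
proof -
  note T = placementsD[OF assms(3)]
  let ?I = "I - fst ` T" and ?J = "J - snd ` T"
  have finT: "finite T"
    using finite_placement[OF _ assms(3)] assms(1,2) by simp
  have cI: "card ?I = card I - card T"
    using T finT by (subst card_Diff_subset) (auto simp: card_image)
  have cJ: "card ?J = card J - card T"
    using T finT by (subst card_Diff_subset) (auto simp: card_image)
  have cU: "card (T \<union> U) = card T + card U" if "U \<in> placements (?I \<times> ?J)" for U
  proof (rule card_Un_disjoint[OF finT])
    show "finite U" using that assms finite_placement[of "?I \<times> ?J"] by simp
    show "T \<inter> U = {}" using placementsD(1)[OF that] by force
  qed
  have "(\<Sum>S | S \<in> placements (I \<times> J) \<and> T \<subseteq> S. falling_factorial x (card I - card S))
      = (\<Sum>U\<in>placements (?I \<times> ?J). falling_factorial x (card I - card (T \<union> U)))"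
    by (rule sum.reindex_bij_betw[OF bij_betw_placements_containing[OF assms(3)], symmetric])
  also have "\<dots> = (\<Sum>U\<in>placements (?I \<times> ?J). falling_factorial x (card ?I - card U))"
    by (intro sum.cong refl) (simp add: cU cI)
  also have "\<dots> = falling_factorial (x + of_nat (card J - card T)) (card I - card T)"
    using sum_placements_rectangle[of ?I ?J x] assms(1,2) unfolding cI cJ by blast
  finally show ?thesis .
qed

text \<open>
  Inclusion-exclusion: the alternating sum over the subsets of \<open>S \<inter> B\<close> vanishes unless
  \<open>S \<inter> B\<close> is empty. Every subset of a placement is again a placement, so these subsets are the
  placements in \<open>B\<close> contained in \<open>S\<close>, and the two sums can be exchanged.
\<close>

lemma sum_placements_avoiding:
  fixes f :: "board \<Rightarrow> 'a::comm_ring_1"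
  assumes "finite A" "B \<subseteq> A"
  shows "(\<Sum>S\<in>placements (A - B). f S)
    = (\<Sum>T\<in>placements B. (- 1) ^ card T * (\<Sum>S | S \<in> placements A \<and> T \<subseteq> S. f S))"
proof -
  have finB: "finite B" using assms finite_subset by blast
  have alt: "(\<Sum>T | T \<in> placements B \<and> T \<subseteq> S. (- 1) ^ card T)
      = (if S \<inter> B = {} then 1 else (0 :: 'a))" if S: "S \<in> placements A" for S
  proof -
    have eq: "{T. T \<in> placements B \<and> T \<subseteq> S} = Pow (S \<inter> B)"
      using placementsD[OF S]
      by (auto simp: placements_def non_attacking_def intro: inj_on_subset)
    show ?thesis
    proof (cases "S \<inter> B = {}")
      case False
      \<comment> \<open>Expand the product of \<open>1 - 1\<close> over \<open>S \<inter> B\<close>.\<close>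
      have "(\<Sum>T\<in>Pow (S \<inter> B). (- 1) ^ card T) = (0 :: 'a)"
        using prod_diff_conv_sum[of "S \<inter> B" "\<lambda>_. 1 :: 'a" "\<lambda>_. 1"] False finB
        by (simp add: Pow_Int_eq power_0_left card_gt_0_iff)
      then show ?thesis using False by (simp add: eq)
    qed (simp add: eq)
  qed
  have "(\<Sum>S\<in>placements (A - B). f S) = (\<Sum>S\<in>{S \<in> placements A. S \<inter> B = {}}. f S)"
    by (rule sum.cong) (auto simp: placements_def)
  also have "\<dots> = (\<Sum>S\<in>placements A. if S \<inter> B = {} then f S else 0)"
    using assms by (simp add: sum.inter_filter)
  also have "\<dots> = (\<Sum>S\<in>placements A. \<Sum>T | T \<in> placements B \<and> T \<subseteq> S. (- 1) ^ card T * f S)"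
    by (intro sum.cong refl) (simp add: sum_distrib_right[symmetric] alt)
  also have "\<dots> = (\<Sum>T\<in>placements B. \<Sum>S | S \<in> placements A \<and> T \<subseteq> S. (- 1) ^ card T * f S)"
    using assms finB by (intro sum.swap_restrict) auto
  finally show ?thesis by (simp add: sum_distrib_left)
qed

section \<open>Reciprocity\<close>

text \<open>
  Both sides run over \<open>x + 1, \<dots>, x + n\<close> up to sign, in opposite orders.
\<close>

lemma falling_factorial_reflect:
  fixes x :: "'a::comm_ring_1"
  shows "falling_factorial (- x - 1) n = (- 1) ^ n * falling_factorial (x + of_nat n) n"
proof -
  have "falling_factorial (- x - 1) n = (\<Prod>j<n. (- 1) * (x + of_nat (Suc j)))"
    unfolding falling_factorial_def by (intro prod.cong) (auto simp: algebra_simps)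
  also have "\<dots> = (- 1) ^ n * (\<Prod>j<n. x + of_nat (Suc j))"
    by (simp only: prod.distrib prod_constant card_lessThan)
  also have "(\<Prod>j<n. x + of_nat (Suc j)) = (\<Prod>j<n. x + of_nat (Suc (n - Suc j)))"
    by (rule prod.nat_diff_reindex[symmetric])
  also have "\<dots> = falling_factorial (x + of_nat n) n"
    unfolding falling_factorial_def
    by (intro prod.cong refl) (simp add: Suc_diff_Suc of_nat_diff algebra_simps)
  finally show ?thesis .
qed

lemma pcompose_falling_factorial:
  fixes p q :: "'a::{comm_ring_1} poly"
  shows "pcompose (falling_factorial p n) q = falling_factorial (pcompose p q) n"
  by (simp add: falling_factorial_def pcompose_prod pcompose_diff of_nat_poly)

theorem proposition13:
  fixes d :: nat and B :: board
  assumes "B \<subseteq> full_board d"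
  shows "factorial_polynomial d (full_board d - B) =
    (- 1) ^ d * pcompose (factorial_polynomial d B) [:- 1, - 1:]"
proof -
  let ?X = "[:0, 1:] :: int poly"
  have X: "[:- 1, - 1:] = - ?X - 1" by (simp add: one_pCons)
  have full: "full_board d = {1..d} \<times> {1..d}" by (simp add: full_board_def)
  have finite_full: "finite (full_board d)" by (simp add: full)
  have T: "T \<in> placements ({1..d} \<times> {1..d})" if "T \<in> placements B" for T
    using that assms by (auto simp: placements_def full)
  have contribution: "(- 1) ^ card T * (\<Sum>S | S \<in> placements (full_board d) \<and> T \<subseteq> S.
        falling_factorial ?X (d - card S))
      = (- 1) ^ d * falling_factorial [:- 1, - 1:] (d - card T)"
    if "T \<in> placements B" for T
  proof -
    have le: "card T \<le> d"
      using card_placement_le_rows[OF _ T[OF that]] by simp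
    have "(- 1 :: int poly) ^ d * (- 1) ^ (d - card T) = (- 1) ^ card T"
      using le by (simp add: power_add[symmetric] minus_one_power_iff)
    moreover have "falling_factorial [:- 1, - 1:] (d - card T)
        = (- 1) ^ (d - card T) * falling_factorial (?X + of_nat (d - card T)) (d - card T)"
      unfolding X by (rule falling_factorial_reflect)
    moreover have "(\<Sum>S | S \<in> placements (full_board d) \<and> T \<subseteq> S. falling_factorial ?X (d - card S))
        = falling_factorial (?X + of_nat (d - card T)) (d - card T)"
      using sum_placements_containing[OF _ _ T[OF that], of ?X] by (simp add: full)
    ultimately show ?thesis by (simp only: mult.assoc[symmetric])
  qed
  have "factorial_polynomial d (full_board d - B)
      = (\<Sum>S\<in>placements (full_board d - B). falling_factorial ?X (d - card S))"
    by (intro factorial_polynomial_eq_sum_placements) auto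
  also have "\<dots> = (\<Sum>T\<in>placements B. (- 1) ^ d * falling_factorial [:- 1, - 1:] (d - card T))"
    unfolding sum_placements_avoiding[OF finite_full assms] by (intro sum.cong refl contribution)
  also have "\<dots> = (- 1) ^ d * pcompose (factorial_polynomial d B) [:- 1, - 1:]"
    unfolding factorial_polynomial_eq_sum_placements[OF assms]
    by (simp add: pcompose_sum pcompose_falling_factorial pcompose_pCons sum_distrib_left)
  finally show ?thesis .
qed

end
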